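(* Let $m,n$ be positive integers, let $l,u\in\mathbb{R}_+^m$, $l',u'\in\mathbb{R}_+^n$ and $L,U\in\mathbb{R}_+$ satisfy $u\ge l$, $u'\ge l'$, $U\ge L$, $u>0$ and $u'>0$ (componentwise). With $\mathcal{T}^1(l,u,l',u',L,U)$ and $\mathcal{T}^2(l,u,l',u',L,U)$ as defined in the context, $$\mathcal{T}^1(l,u,l',u',L,U)\supseteq \mathcal{T}^2(l,u,l',u',L,U).$$
   Context: $[k]=\{1,\dots,k\}$; $\mathbb{R}_+$ denotes the nonnegative reals; $X=(x_{ij})$, $R=(r_{ij})$. Define $\tilde{\mathcal{T}}(l,u,\cdot,\cdot,L,U)$ (column bounds relaxed) as the set of $X\in\mathbb{R}_+^{m\times n}$ with $\operatorname{rank}(X)\le 1$, $l_i\le\sum_{j=1}^n x_{ij}\le u_i$ for all $i\in[m]$, and $L\le\sum_{i=1}^m\sum_{j=1}^n x_{ij}\le U$. Define $\tilde{\mathcal{T}}(\cdot,\cdot,l',u',L,U)$ (row bounds relaxed) as the set of $X\in\mathbb{R}_+^{m\times n}$ with $\operatorname{rank}(X)\le 1$, $l'_j\le\sum_{i=1}^m x_{ij}\le u'_j$ for all $j\in[n]$, and $L\le\sum_{i=1}^m\sum_{j=1}^n x_{ij}\le U$. Then $$\mathcal{T}^1(l,u,l',u',L,U):=\operatorname{conv}(\tilde{\mathcal{T}}(l,u,\cdot,\cdot,L,U))\cap\operatorname{conv}(\tilde{\mathcal{T}}(\cdot,\cdot,l',u',L,U)).$$ It is a known result (Dey, Kocuk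 and Santana) that $\operatorname{conv}(\tilde{\mathcal{T}}(l,u,\cdot,\cdot,L,U))$ is the set of $X\in\mathbb{R}_+^{m\times n}$ for which there is $t\in\mathbb{R}_+^n$ with $l_it_j\le x_{ij}\le u_it_j$ for all $i,j$, $Lt_j\le\sum_{i=1}^m x_{ij}\le Ut_j$ for all $j$, and $\sum_{j=1}^n t_j=1$; and that $\operatorname{conv}(\tilde{\mathcal{T}}(\cdot,\cdot,l',u',L,U))$ is the set of $X\in\mathbb{R}_+^{m\times n}$ for which there is $t'\in\mathbb{R}_+^m$ with $l'_jt'_i\le x_{ij}\le u'_jt'_i$ for all $i,j$, $Lt'_i\le\sum_{j=1}^n x_{ij}\le Ut'_i$ for all $i$, and $\sum_{i=1}^m t'_i=1$. $\mathcal{T}^2(l,u,l',u',L,U)$ is the set of $X\in\mathbb{R}_+^{m\times n}$ for which there exists $R\in\mathbb{R}_+^{m\times n}$ such that, for all $i\in[m]$, $j\in[n]$, $$l_i\sum_{i'=1}^m r_{i'j}\le x_{ij}\le u_i\sum_{i'=1}^m r_{i'j},\qquad Lr_{ij}\le x_{ij}\le Ur_{ij},\qquad l'_j\sum_{j'=1}^n r_{ij'}\le x_{ij}\le u'_j\sum_{j'=1}^n r_{ij'},$$ and $\sum_{i=1}^m\sum_{j=1}^n r_{ij}=1$. *)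

theory Defs
  imports "HOL-Analysis.Analysis"
begin

text \<open>
  An m-by-n matrix is an element of \<open>real^'n^'m\<close>, so \<open>X $ i $ j\<close> is the entry in
  row \<open>i :: 'm\<close> and column \<open>j :: 'n\<close>. Both dimensions are positive since types are nonempty.
\<close>

definition T_row :: "real^'m \<Rightarrow> real^'m \<Rightarrow> real \<Rightarrow> real \<Rightarrow> (real^'n^'m) set" where
  "T_row l u L U = {X.
      (\<forall>i j. 0 \<le> X $ i $ j) \<and> rank X \<le> 1 \<and>
      (\<forall>i. l $ i \<le> (\<Sum>j\<in>UNIV. X $ i $ j) \<and> (\<Sum>j\<in>UNIV. X $ i $ j) \<le> u $ i) \<and>
      L \<le> (\<Sum>i\<in>UNIV. \<Sum>j\<in>UNIV. X $ i $ j) \<and> (\<Sum>i\<in>UNIV. \<Sum>j\<in>UNIV. X $ i $ j) \<le> U}"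

definition T_col :: "real^'n \<Rightarrow> real^'n \<Rightarrow> real \<Rightarrow> real \<Rightarrow> (real^'n^'m) set" where
  "T_col l' u' L U = {X.
      (\<forall>i j. 0 \<le> X $ i $ j) \<and> rank X \<le> 1 \<and>
      (\<forall>j. l' $ j \<le> (\<Sum>i\<in>UNIV. X $ i $ j) \<and> (\<Sum>i\<in>UNIV. X $ i $ j) \<le> u' $ j) \<and>
      L \<le> (\<Sum>i\<in>UNIV. \<Sum>j\<in>UNIV. X $ i $ j) \<and> (\<Sum>i\<in>UNIV. \<Sum>j\<in>UNIV. X $ i $ j) \<le> U}"

definition T1 ::
  "real^'m \<Rightarrow> real^'m \<Rightarrow> real^'n \<Rightarrow> real^'n \<Rightarrow> real \<Rightarrow> real \<Rightarrow> (real^'n^'m) set" where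
  "T1 l u l' u' L U = (convex hull T_row l u L U) \<inter> (convex hull T_col l' u' L U)"

definition T2 ::
  "real^'m \<Rightarrow> real^'m \<Rightarrow> real^'n \<Rightarrow> real^'n \<Rightarrow> real \<Rightarrow> real \<Rightarrow> (real^'n^'m) set" where
  "T2 l u l' u' L U = {X. (\<forall>i j. 0 \<le> X $ i $ j) \<and>
      (\<exists>R :: real^'n^'m. (\<forall>i j. 0 \<le> R $ i $ j) \<and>
        (\<forall>i j.
          l $ i * (\<Sum>i'\<in>UNIV. R $ i' $ j) \<le> X $ i $ j \<and>
          X $ i $ j \<le> u $ i * (\<Sum>i'\<in>UNIV. R $ i' $ j) \<and>
          L * R $ i $ j \<le> X $ i $ j \<and> X $ i $ j \<le> U * R $ i $ j \<and>
          l' $ j * (\<Sum>j'\<in>UNIV. R $ i $ j') \<le> X $ i $ j \<and>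
          X $ i $ j \<le> u' $ j * (\<Sum>j'\<in>UNIV. R $ i $ j')) \<and>
        (\<Sum>i\<in>UNIV. \<Sum>j\<in>UNIV. R $ i $ j) = 1)}"

end

theory Submission
  imports Defs
begin

text \<open>
  A nonnegative matrix is the sum of its columns, each viewed as a matrix with only one nonzero
  column, hence of rank at most one. Given weights \<open>t\<^sub>j\<close> summing to one, dividing column \<open>j\<close> by
  \<open>t\<^sub>j\<close> turns this sum into a convex combination, and the bounds relating \<open>x\<^sub>i\<^sub>j\<close> to \<open>t\<^sub>j\<close> say
  precisely that the scaled column satisfies the row and total bounds. For a point of \<open>T2\<close> with
  witness \<open>R\<close>, the column sums of \<open>R\<close> serve as weights for the row relaxation and, after
  transposition, the row sums serve for the column relaxation.
\<close>

lemma rank_single_column_le_1: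
  fixes v :: "'m::finite \<Rightarrow> real" and j :: "'n::finite"
  shows "rank ((\<chi> i k. if k = j then v i else 0) :: real^'n^'m) \<le> 1"
proof -
  let ?A = "(\<chi> i k. if k = j then v i else 0) :: real^'n^'m"
  have "columns ?A \<subseteq> span {\<chi> i. v i}"
  proof
    fix c assume "c \<in> columns ?A"
    then obtain k where k: "c = column k ?A" by (auto simp: columns_def)
    show "c \<in> span {\<chi> i. v i}"
    proof (cases "k = j")
      case True
      then have "c = (\<chi> i. v i)" using k by (simp add: column_def)
      then show ?thesis by (simp add: span_base)
    next
      case False
      then have "c = 0" using k by (simp add: column_def vec_eq_iff)
      then show ?thesis by (simp add: span_zero)
    qed
  qed
  then have "dim (columns ?A) \<le> card {\<chi> i. v i}" by (intro dim_le_card) auto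
  then show ?thesis by (simp add: column_rank_def)
qed

text \<open>The sufficiency half of the extended description of the hull: a weight vector
  \<open>t\<close> certifies membership by exhibiting \<open>X\<close> as an explicit convex
  combination.\<close>

lemma convex_hull_T_rowI:
  fixes X :: "real^'n^'m" and t :: "'n::finite \<Rightarrow> real"
  assumes X: "\<And>i j. 0 \<le> X $ i $ j"
    and t: "\<And>j. 0 \<le> t j" "(\<Sum>j\<in>UNIV. t j) = 1"
    and row: "\<And>i j. l $ i * t j \<le> X $ i $ j" "\<And>i j. X $ i $ j \<le> u $ i * t j"
    and tot: "\<And>j. L * t j \<le> (\<Sum>i\<in>UNIV. X $ i $ j)" "\<And>j. (\<Sum>i\<in>UNIV. X $ i $ j) \<le> U * t j"
  shows "X \<in> convex hull T_row l u L U"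
proof -
  \<comment> \<open>Only columns of nonzero weight can be rescaled by
    \<open>1 / t j\<close>.\<close>
  define S where "S = {j. t j \<noteq> 0}"
  define Y :: "'n \<Rightarrow> real^'n^'m"
    where "Y j = (\<chi> i k. if k = j then X $ i $ j / t j else 0)" for j
  have Y: "Y j \<in> T_row l u L U" if "j \<in> S" for j
  proof -
    have pos: "0 < t j" using that t(1)[of j] by (simp add: S_def)
    have "rank (Y j) \<le> 1" unfolding Y_def by (rule rank_single_column_le_1)
    \<comment> \<open>Each row of \<open>Y j\<close> has a single possibly nonzero entry, so the row
      bounds become the entrywise bounds on column \<open>j\<close> divided by
      \<open>t j\<close>.\<close>
    moreover have "(\<Sum>k\<in>UNIV. Y j $ i $ k) = X $ i $ j / t j" for i
      by (simp add: Y_def)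
    ultimately show ?thesis
      using X row tot[of j] pos
      by (auto simp: T_row_def pos_le_divide_eq pos_divide_le_eq simp flip: sum_divide_distrib)
        (simp add: Y_def)
  qed
  \<comment> \<open>At weight zero the upper bound \<open>u $ i * t j\<close> vanishes, so
    nonnegativity forces the whole column to be zero and the sum over \<open>S\<close> still
    recovers \<open>X\<close>.\<close>
  have zero: "X $ i $ j = 0" if "j \<notin> S" for i j
    using that X[of i j] row(2)[of i j] by (simp add: S_def)
  have "(\<Sum>j\<in>S. t j *\<^sub>R Y j) = X"
    using zero by (auto simp: vec_eq_iff Y_def if_distrib S_def cong: if_cong)
  moreover have "(\<Sum>j\<in>S. t j *\<^sub>R Y j) \<in> convex hull T_row l u L U"
  proof (rule convex_sum)
    have "(\<Sum>j\<in>S. t j) = (\<Sum>j\<in>UNIV. t j)"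
      by (rule sum.mono_neutral_left) (auto simp: S_def)
    then show "(\<Sum>j\<in>S. t j) = 1" using t(2) by simp
  qed (auto simp: t Y hull_inc)
  ultimately show ?thesis by simp
qed

text \<open>Transposition swaps row sums with column sums and preserves rank, sign and total. This
  lets the column case be derived from the row case.\<close>

lemma T_col_eq_transpose_image:
  "(T_col l' u' L U :: (real^'n^'m) set) = transpose ` T_row l' u' L U"
proof -
  have "X \<in> T_col l' u' L U \<longleftrightarrow> transpose X \<in> T_row l' u' L U" for X :: "real^'n^'m"
  proof -
    have "(\<Sum>i\<in>UNIV. \<Sum>j\<in>UNIV. X $ i $ j) = (\<Sum>j\<in>UNIV. \<Sum>i\<in>UNIV. X $ i $ j)"
      by (rule sum.swap)
    moreover have "transpose X $ j $ i = X $ i $ j" for i j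
      by (simp add: transpose_def)
    ultimately show ?thesis
      unfolding T_col_def T_row_def mem_Collect_eq rank_transpose by auto
  qed
  then have "(T_col l' u' L U :: (real^'n^'m) set) = {X. transpose X \<in> T_row l' u' L U}" by blast
  \<comment> \<open>Preimage and image agree because transposition is an involution.\<close>
  also have "\<dots> = transpose ` T_row l' u' L U"
  proof (intro equalityI subsetI)
    fix X :: "real^'n^'m" assume "X \<in> {X. transpose X \<in> T_row l' u' L U}"
    then have "transpose (transpose X) \<in> transpose ` T_row l' u' L U"
      unfolding mem_Collect_eq by (rule imageI)
    then show "X \<in> transpose ` T_row l' u' L U" by simp
  qed auto
  finally show ?thesis .
qed

lemma linear_transpose: "linear (transpose :: real^'n^'m \<Rightarrow> real^'m^'n)"
  by (rule linearI) (simp_all add: transpose_def vec_eq_iff)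

lemma convex_hull_T_colI:
  fixes X :: "real^'n^'m" and t :: "'m::finite \<Rightarrow> real"
  assumes "\<And>i j. 0 \<le> X $ i $ j"
    and "\<And>i. 0 \<le> t i" "(\<Sum>i\<in>UNIV. t i) = 1"
    and "\<And>i j. l' $ j * t i \<le> X $ i $ j" "\<And>i j. X $ i $ j \<le> u' $ j * t i"
    and "\<And>i. L * t i \<le> (\<Sum>j\<in>UNIV. X $ i $ j)" "\<And>i. (\<Sum>j\<in>UNIV. X $ i $ j) \<le> U * t i"
  shows "X \<in> convex hull T_col l' u' L U"
proof -
  have "transpose X \<in> convex hull T_row l' u' L U"
    by (rule convex_hull_T_rowI[where t = t]) (simp_all add: transpose_def assms)
  \<comment> \<open>A linear map commutes with taking convex hulls.\<close>
  then have "transpose (transpose X) \<in> convex hull T_col l' u' L U"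
    unfolding T_col_eq_transpose_image convex_hull_linear_image[OF linear_transpose, symmetric]
    by (rule imageI)
  then show ?thesis by simp
qed

theorem proposition3:
  fixes l u :: "real^'m" and l' u' :: "real^'n" and L U :: real
  assumes "\<forall>i. 0 \<le> l $ i" and "\<forall>i. l $ i \<le> u $ i" and "\<forall>i. 0 < u $ i"
    and "\<forall>j. 0 \<le> l' $ j" and "\<forall>j. l' $ j \<le> u' $ j" and "\<forall>j. 0 < u' $ j"
    and "0 \<le> L" and "L \<le> U"
  shows "T1 l u l' u' L U \<supseteq> T2 l u l' u' L U"
proof
  fix X :: "real^'n^'m" assume X_T2: "X \<in> T2 l u l' u' L U"
  from X_T2 have X: "0 \<le> X $ i $ j" for i j by (simp add: T2_def)
  from conjunct2[OF X_T2[unfolded T2_def mem_Collect_eq]] obtain R :: "real^'n^'m" where R_ex: "(\<forall>i j. 0 \<le> R $ i $ j) \<and>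
        (\<forall>i j.
          l $ i * (\<Sum>i'\<in>UNIV. R $ i' $ j) \<le> X $ i $ j \<and>
          X $ i $ j \<le> u $ i * (\<Sum>i'\<in>UNIV. R $ i' $ j) \<and>
          L * R $ i $ j \<le> X $ i $ j \<and> X $ i $ j \<le> U * R $ i $ j \<and>
          l' $ j * (\<Sum>j'\<in>UNIV. R $ i $ j') \<le> X $ i $ j \<and>
          X $ i $ j \<le> u' $ j * (\<Sum>j'\<in>UNIV. R $ i $ j')) \<and>
        (\<Sum>i\<in>UNIV. \<Sum>j\<in>UNIV. R $ i $ j) = 1"
    by (rule exE)
  then have R: "0 \<le> R $ i $ j"
    and row: "l $ i * (\<Sum>i'\<in>UNIV. R $ i' $ j) \<le> X $ i $ j"
      "X $ i $ j \<le> u $ i * (\<Sum>i'\<in>UNIV. R $ i' $ j)"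
    and tot: "L * R $ i $ j \<le> X $ i $ j" "X $ i $ j \<le> U * R $ i $ j"
    and col: "l' $ j * (\<Sum>j'\<in>UNIV. R $ i $ j') \<le> X $ i $ j"
      "X $ i $ j \<le> u' $ j * (\<Sum>j'\<in>UNIV. R $ i $ j')" for i j
    by simp_all
  from R_ex have one: "(\<Sum>i\<in>UNIV. \<Sum>j\<in>UNIV. R $ i $ j) = 1" by (elim conjE)
  have one': "(\<Sum>j\<in>UNIV. \<Sum>i\<in>UNIV. R $ i $ j) = 1"
    using one by (subst sum.swap)
  \<comment> \<open>The total bounds for column \<open>j\<close> come from summing the entrywise
    bounds \<open>tot\<close> over \<open>i\<close>; in the column relaxation below they are summed
    over \<open>j\<close>.\<close>
  have "X \<in> convex hull T_row l u L U"
    by (rule convex_hull_T_rowI[where t = "\<lambda>j. \<Sum>i\<in>UNIV. R $ i $ j"])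
      (simp_all add: X R row one' sum_nonneg,
       simp_all add: sum_distrib_left sum_mono tot)
  moreover have "X \<in> convex hull T_col l' u' L U"
    by (rule convex_hull_T_colI[where t = "\<lambda>i. \<Sum>j\<in>UNIV. R $ i $ j"])
      (simp_all add: X R col one sum_nonneg,
       simp_all add: sum_distrib_left sum_mono tot)
  ultimately show "X \<in> T1 l u l' u' L U" by (simp add: T1_def)
qed

end
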